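(* Assume that $\{f;\,f_t,t\in T\}\subset\Gamma(X)$ and $E\cap\operatorname{dom}f\ne\emptyset$. The following statements are equivalent: (i) $\inf(\mathrm{P})=\sup(\mathrm{D})$. (ii) $\overline{\mathcal{A}}\cap\left(\{0_{X^*}\}\times\mathbb{R}\right)=\overline{\mathcal{A}\cap\left(\{0_{X^*}\}\times\mathbb{R}\right)}$.
   Context: $X$ is a locally convex Hausdorff (real) topological vector space; its topological dual $X^*$ (null element $0_{X^*}$) carries the weak*-topology and $X^*\times\mathbb{R}$ the product topology; overlines denote closures in this topology. $T$ is an infinite index set. $\Gamma(X)$ is the class of lower semicontinuous proper convex functions $X\to\mathbb{R}\cup\{+\infty\}$. The convention $0\times(+\infty)=0$ is used. $E:=\{x\in X:f_t(x)\le0\ \forall t\in T\}$. For $h:X\to\overline{\mathbb{R}}$, $h^*(x^* )=\sup_{x\in X}\{\langle x^*,x\rangle-h(x)\}$ and $\operatorname{epi}h^*=\{(x^*,r)\in X^*\times\mathbb{R}:h^*(x^* )\le r\}$. $\mathbb{R}_+^{(T)}$ is the set of finitely supported functions $\lambda:T\to\mathbb{R}_+$; $\sum_{t\in T}\lambda_tf_t$ denotes the sum over the support of $\lambda$ (the zero function if the support is empty). $(\mathrm{P})$: $\inf f(x)$ s.t. $f_t(x)\le0$, $t\in T$. $(\mathrm{D})$: $\sup_{\lambda\in\mathbb{R}_+^{(T)}}\inf_{x\in X}\left\{f(x)+\sum_{t\in T}\lambda_tf_t(x)\right\}$. $\mathcal{A}:=\bigcup_{\lambda\in\mathbb{R}_+^{(T)}}\operatorname{epi}\left(f+\sum_{t\in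 T}\lambda_tf_t\right)^*\subset X^*\times\mathbb{R}$. *)

theory Defs
  imports "HOL-Analysis.Analysis"
begin

text \<open>Real Hausdorff locally convex topological vector spaces. The quantified condition on \<open>V\<close> is
  the definition of \<^const>\<open>convex\<close>, unfolded because that constant carries a sort constraint that a
  class specification does not admit.\<close>

class locally_convex_t2 = real_vector + topological_ab_group_add + t2_space +
  assumes tendsto_scaleR_Pair:
    "((\<lambda>p. fst p *\<^sub>R snd p) \<longlongrightarrow> a *\<^sub>R x) (nhds (a :: real) \<times>\<^sub>F nhds x)"
  and locally_convex_0:
    "open U \<Longrightarrow> 0 \<in> U \<Longrightarrow> \<exists>V. open V \<and> 0 \<in> V \<and> V \<subseteq> U \<and>
       (\<forall>x\<in>V. \<forall>y\<in>V. \<forall>u\<ge>0. \<forall>v\<ge>0. u + v = 1 \<longrightarrow> u *\<^sub>R x + v *\<^sub>R y \<in> V)"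

lemma locally_convex_0_convex:
  fixes U :: "'a::locally_convex_t2 set"
  assumes "open U" "0 \<in> U"
  shows "\<exists>V. open V \<and> 0 \<in> V \<and> V \<subseteq> U \<and> convex V"
  using locally_convex_0[OF assms] unfolding convex_def .

instance real_normed_vector \<subseteq> locally_convex_t2
proof
  fix a :: real and x :: 'a
  show "((\<lambda>p. fst p *\<^sub>R snd p) \<longlongrightarrow> a *\<^sub>R x) (nhds a \<times>\<^sub>F nhds x)"
    by (intro tendsto_scaleR filterlim_fst filterlim_snd)
next
  fix U :: "'a set"
  assume "open U" "0 \<in> U"
  then obtain e where "e > 0" "ball 0 e \<subseteq> U"
    using open_contains_ball by blast
  then show "\<exists>V. open V \<and> 0 \<in> V \<and> V \<subseteq> U \<and>
       (\<forall>x\<in>V. \<forall>y\<in>V. \<forall>u\<ge>0. \<forall>v\<ge>0. u + v = 1 \<longrightarrow> u *\<^sub>R x + v *\<^sub>R y \<in> V)"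
    using convex_ball[of "0::'a" e, unfolded convex_def]
    by (intro exI[of _ "ball 0 e"]) simp
qed

definition topological_dual :: "('a::locally_convex_t2 \<Rightarrow> real) set" where
  "topological_dual = {\<phi>. linear \<phi> \<and> continuous_on UNIV \<phi>}"

text \<open>The topology of pointwise convergence, i.e. the one induced on the dual by the product
  topology on all functions into the reals.\<close>

definition weak_star_topology :: "('a::locally_convex_t2 \<Rightarrow> real) topology" where
  "weak_star_topology = subtopology (powertop_real UNIV) topological_dual"

definition lower_semicontinuous :: "('a::topological_space \<Rightarrow> ereal) \<Rightarrow> bool" where
  "lower_semicontinuous h \<longleftrightarrow> (\<forall>x. \<forall>r < h x. \<forall>\<^sub>F y in nhds x. r < h y)"

text \<open>Convexity of a function that nowhere takes the value \<open>-\<infinity>\<close>; the right-hand side then never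
  contains \<open>\<infinity> - \<infinity>\<close>, and \<open>0 * \<infinity> = 0\<close> holds in \<^typ>\<open>ereal\<close>.\<close>

definition convex_ereal :: "('a::real_vector \<Rightarrow> ereal) \<Rightarrow> bool" where
  "convex_ereal h \<longleftrightarrow> (\<forall>x y. \<forall>u\<ge>0. \<forall>v\<ge>0. u + v = 1 \<longrightarrow>
     h (u *\<^sub>R x + v *\<^sub>R y) \<le> ereal u * h x + ereal v * h y)"

definition effective_domain :: "('a \<Rightarrow> ereal) \<Rightarrow> 'a set" where
  "effective_domain h = {x. h x < \<infinity>}"

definition proper_convex_lsc :: "('a::locally_convex_t2 \<Rightarrow> ereal) set" where
  "proper_convex_lsc =
     {h. (\<forall>x. h x \<noteq> -\<infinity>) \<and> effective_domain h \<noteq> {} \<and> convex_ereal h \<and> lower_semicontinuous h}"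

definition conjugate :: "('a \<Rightarrow> ereal) \<Rightarrow> ('a \<Rightarrow> real) \<Rightarrow> ereal" where
  "conjugate h \<phi> = (SUP x. ereal (\<phi> x) - h x)"

definition epi_conjugate :: "('a::locally_convex_t2 \<Rightarrow> ereal) \<Rightarrow> (('a \<Rightarrow> real) \<times> real) set" where
  "epi_conjugate h = {(\<phi>, r). \<phi> \<in> topological_dual \<and> conjugate h \<phi> \<le> ereal r}"

definition feasible_set :: "'i set \<Rightarrow> ('i \<Rightarrow> 'a \<Rightarrow> ereal) \<Rightarrow> 'a set" where
  "feasible_set T g = {x. \<forall>t\<in>T. g t x \<le> 0}"

text \<open>Finitely supported nonnegative functions on \<open>T\<close>, represented by their extension by zero.\<close>

definition multipliers :: "'i set \<Rightarrow> ('i \<Rightarrow> real) set" where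
  "multipliers T = {l. (\<forall>t. 0 \<le> l t) \<and> {t. l t \<noteq> 0} \<subseteq> T \<and> finite {t. l t \<noteq> 0}}"

definition lagrangian ::
  "('a \<Rightarrow> ereal) \<Rightarrow> ('i \<Rightarrow> 'a \<Rightarrow> ereal) \<Rightarrow> ('i \<Rightarrow> real) \<Rightarrow> 'a \<Rightarrow> ereal" where
  "lagrangian f g l = (\<lambda>x. f x + (\<Sum>t | l t \<noteq> 0. ereal (l t) * g t x))"

definition primal_value :: "'i set \<Rightarrow> ('a \<Rightarrow> ereal) \<Rightarrow> ('i \<Rightarrow> 'a \<Rightarrow> ereal) \<Rightarrow> ereal" where
  "primal_value T f g = (INF x \<in> feasible_set T g. f x)"

definition dual_value :: "'i set \<Rightarrow> ('a \<Rightarrow> ereal) \<Rightarrow> ('i \<Rightarrow> 'a \<Rightarrow> ereal) \<Rightarrow> ereal" where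
  "dual_value T f g = (SUP l \<in> multipliers T. INF x. lagrangian f g l x)"

definition characteristic_set ::
  "'i set \<Rightarrow> ('a::locally_convex_t2 \<Rightarrow> ereal) \<Rightarrow> ('i \<Rightarrow> 'a \<Rightarrow> ereal) \<Rightarrow> (('a \<Rightarrow> real) \<times> real) set"
  where "characteristic_set T f g = (\<Union>l \<in> multipliers T. epi_conjugate (lagrangian f g l))"

end

theory Submission
  imports Defs "HOL-Library.Function_Algebras"
begin

text \<open>The characteristic set \<open>A\<close> is the union of the epigraphs of the conjugates of all Lagrangians. A point
  \<open>(0, r)\<close> lies in \<open>A\<close> iff some Lagrangian is bounded below by \<open>- r\<close>, so the closure of
  \<open>A \<inter> ({0} \<times> \<real>)\<close> consists of the \<open>(0, r)\<close> with \<open>- r \<le> sup (D)\<close>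
  (\<open>closure_dual_levels\<close>). On the other hand, the closure of \<open>A\<close> is the epigraph of the conjugate
  of \<open>f\<close> restricted to the feasible set, so its intersection with \<open>{0} \<times> \<real>\<close> consists of the
  \<open>(0, r)\<close> with \<open>- r \<le> inf (P)\<close>. The two sets agree iff \<open>inf (P)\<close> and \<open>sup (D)\<close> have the same
  real lower bounds, that is, iff they are equal.

  The substance is the formula for the closure of \<open>A\<close>. One inclusion is weak duality
  (\<open>closure_characteristic_set_le\<close>). For the other one (\<open>closure_characteristic_set_ge\<close>), a pair
  outside the closure is separated from the convex set \<open>A\<close> by a weak-star continuous functional on
  the product, that is, by a point of the space and a real coefficient (\<open>weak_star_separation\<close>).
  After a normalization of the coefficient there remains a point \<open>x\<close>, and the separation bounds \<open>\<phi> x - s\<close> for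
  all continuous affine minorants \<open>\<phi> - s\<close> of \<open>f\<close> and of \<open>f + c g t\<close> with \<open>c > 0\<close>. Since these
  functions are the suprema of their affine minorants (\<open>exists_epi_conjugate\<close>), their values at
  \<open>x\<close> obey the same bound; letting \<open>c\<close> grow shows that \<open>x\<close> is feasible
  (\<open>characteristic_set_bound_imp_feasible\<close>) and contradicts the lower bound on the feasible set.

  Both the separation and the Fenchel-Moreau theorem rest on one sandwich theorem, \<open>affine_minorant\<close>,
  which is derived from the existence of linear functionals below sublinear ones.\<close>

section \<open>Linear functionals below sublinear functions\<close>

definition sublinear :: "('a::real_vector \<Rightarrow> real) \<Rightarrow> bool" where
  "sublinear p \<longleftrightarrow> (\<forall>x y. p (x + y) \<le> p x + p y) \<and> (\<forall>c>0. \<forall>x. p (c *\<^sub>R x) = c * p x)"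

lemma sublinear_zero: "sublinear p \<Longrightarrow> p 0 = 0"
proof -
  assume "sublinear p"
  then have "p (2 *\<^sub>R 0) = 2 * p 0"
    unfolding sublinear_def by (meson zero_less_numeral)
  then show ?thesis by simp
qed

lemma sublinear_scaleR:
  assumes "sublinear p" "0 \<le> c"
  shows "p (c *\<^sub>R x) = c * p x"
  using assms sublinear_zero[OF assms(1)] by (cases "c = 0") (auto simp: sublinear_def)

lemma sublinear_add: "sublinear p \<Longrightarrow> p (x + y) \<le> p x + p y"
  by (simp add: sublinear_def)

text \<open>Minkowski gauges, infimal convolutions and infima of chains are all of the form
  \<open>x \<mapsto> Inf (S x)\<close>, where \<open>S x\<close> collects the admissible values at \<open>x\<close>. Subadditivity and
  homogeneity only require that admissible values can be added and scaled, up to making them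
  smaller.\<close>

lemma sublinear_Inf:
  fixes S :: "'a::real_vector \<Rightarrow> real set"
  assumes nonempty: "\<And>x. S x \<noteq> {}"
    and bdd: "\<And>x. bdd_below (S x)"
    and add: "\<And>x y a b. a \<in> S x \<Longrightarrow> b \<in> S y \<Longrightarrow> \<exists>k\<in>S (x + y). k \<le> a + b"
    and scale: "\<And>x a c. 0 < c \<Longrightarrow> a \<in> S x \<Longrightarrow> \<exists>k\<in>S (c *\<^sub>R x). k \<le> c * a"
  shows "sublinear (\<lambda>x. Inf (S x))"
proof -
  have lower: "Inf (S x) \<le> a" if "\<exists>k\<in>S x. k \<le> a" for x a
    using that bdd cInf_lower order_trans by blast
  have sub: "Inf (S (x + y)) \<le> Inf (S x) + Inf (S y)" for x y
  proof -
    have "Inf (S (x + y)) - a \<le> Inf (S y)" if "a \<in> S x" for a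
    proof (rule cInf_greatest[OF nonempty])
      fix b assume "b \<in> S y"
      from lower[OF add[OF that this]] show "Inf (S (x + y)) - a \<le> b" by simp
    qed
    then have "Inf (S (x + y)) - Inf (S y) \<le> Inf (S x)"
      by (intro cInf_greatest nonempty) (simp add: algebra_simps)
    then show ?thesis by simp
  qed
  have le: "Inf (S (c *\<^sub>R x)) \<le> c * Inf (S x)" if "0 < c" for c x
  proof -
    have "Inf (S (c *\<^sub>R x)) / c \<le> Inf (S x)"
      using lower[OF scale[OF that]] that
      by (intro cInf_greatest nonempty) (simp add: divide_simps mult.commute)
    then show ?thesis using that by (simp add: divide_simps mult.commute)
  qed
  have "Inf (S (c *\<^sub>R x)) = c * Inf (S x)" if "0 < c" for c x
    using le[OF that, of x] le[of "1 / c" "c *\<^sub>R x"] that by (simp add: divide_simps mult.commute)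
  with sub show ?thesis by (simp add: sublinear_def)
qed

text \<open>Zorn's lemma for the reversed pointwise order. A chain has its pointwise infimum as a bound: the
  infimum is finite because \<open>- P (- x) \<le> - q (- x) \<le> q x\<close> whenever \<open>q \<le> P\<close>, and it is sublinear
  because two members of a chain can be replaced by the smaller one.\<close>

lemma exists_minimal_sublinear:
  fixes P :: "'a::real_vector \<Rightarrow> real"
  assumes P: "sublinear P"
  shows "\<exists>q. sublinear q \<and> q \<le> P \<and> (\<forall>q'. sublinear q' \<longrightarrow> q' \<le> q \<longrightarrow> q' = q)"
proof -
  define A where "A = {q. sublinear q \<and> q \<le> P}"
  have "partial_order_on A (relation_of (\<lambda>q q'. q' \<le> q) A)"
    by (rule partial_order_on_relation_ofI) auto
  moreover have "\<exists>u\<in>A. \<forall>a\<in>C. u \<le> a"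
    if C: "C \<in> Chains (relation_of (\<lambda>q q'. q' \<le> q) A)" for C
  proof (cases "C = {}")
    case True
    then show ?thesis using P by (auto simp: A_def)
  next
    case False
    have chain: "a \<in> A \<and> b \<in> A \<and> (a \<le> b \<or> b \<le> a)" if "a \<in> C" "b \<in> C" for a b
      using C that by (auto simp: Chains_def relation_of_def)
    define S where "S x = (\<lambda>q. q x) ` C" for x :: 'a
    have bdd: "bdd_below (S x)" for x
    proof (rule bdd_belowI)
      fix a assume "a \<in> S x"
      then obtain q where q: "q \<in> C" "a = q x" by (auto simp: S_def)
      then have "sublinear q" "q (- x) \<le> P (- x)"
        using chain by (auto simp: A_def le_fun_def)
      then show "- P (- x) \<le> a"
        using q sublinear_zero[of q] sublinear_add[of q x "- x"] by simp
    qed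
    have "sublinear (\<lambda>x. Inf (S x))"
    proof (rule sublinear_Inf[OF _ bdd])
      show "S x \<noteq> {}" for x using False by (simp add: S_def)
    next
      fix x y a b assume "a \<in> S x" "b \<in> S y"
      then obtain q r where qr: "q \<in> C" "r \<in> C" "a = q x" "b = r y" by (auto simp: S_def)
      obtain m where m: "m \<in> C" "m \<le> q" "m \<le> r" using chain[OF qr(1,2)] qr by auto
      then have "m (x + y) \<le> m x + m y"
        using chain by (auto simp: A_def intro: sublinear_add)
      also have "\<dots> \<le> a + b" using m qr by (auto simp: le_fun_def intro: add_mono)
      finally show "\<exists>k\<in>S (x + y). k \<le> a + b" using m by (auto simp: S_def)
    next
      fix x a and c :: real assume c: "0 < c" and "a \<in> S x"
      then obtain q where q: "q \<in> C" "a = q x" by (auto simp: S_def)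
      then have "q (c *\<^sub>R x) \<le> c * a" using chain c by (auto simp: A_def sublinear_def)
      then show "\<exists>k\<in>S (c *\<^sub>R x). k \<le> c * a"
        using q unfolding S_def by (intro bexI[OF _ imageI[of q]])
    qed
    moreover have low: "Inf (S x) \<le> q x" if "q \<in> C" for q x
      using that by (auto simp: S_def intro!: cInf_lower bdd[unfolded S_def])
    moreover obtain q0 where "q0 \<in> C" using False by auto
    moreover have "Inf (S x) \<le> P x" for x
      using low[OF \<open>q0 \<in> C\<close>, of x] chain[OF \<open>q0 \<in> C\<close> \<open>q0 \<in> C\<close>]
      by (auto simp: A_def le_fun_def intro: order_trans)
    ultimately show ?thesis
      by (intro bexI[of _ "\<lambda>x. Inf (S x)"]) (auto simp: A_def le_fun_def)
  qed
  ultimately obtain m where "m \<in> A" "\<forall>a\<in>A. a \<le> m \<longrightarrow> a = m"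
    using predicate_Zorn[of A "\<lambda>q q'. q' \<le> q"] by blast
  then show ?thesis by (auto simp: A_def intro: order_trans)
qed

text \<open>For fixed \<open>y\<close>, the function \<open>x \<mapsto> Inf {q (x + t y) - t q y | t \<ge> 0}\<close> is sublinear and at most
  \<open>q\<close>, so by minimality it is \<open>q\<close> itself; comparing with \<open>t = 1\<close> gives
  \<open>q x + q y \<le> q (x + y)\<close>.\<close>

lemma minimal_sublinear_imp_linear:
  fixes q :: "'a::real_vector \<Rightarrow> real"
  assumes q: "sublinear q" and minimal: "\<And>q'. sublinear q' \<Longrightarrow> q' \<le> q \<Longrightarrow> q' = q"
  shows "linear q"
proof -
  have super: "q x + q y \<le> q (x + y)" for x y
  proof -
    define S where "S x = (\<lambda>t. q (x + t *\<^sub>R y) - t * q y) ` {0..}" for x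
    have bdd: "bdd_below (S x)" for x
    proof (rule bdd_belowI)
      fix a assume "a \<in> S x"
      then obtain t where t: "0 \<le> t" "a = q (x + t *\<^sub>R y) - t * q y" by (auto simp: S_def)
      then show "- q (- x) \<le> a"
        using sublinear_add[OF q, of "x + t *\<^sub>R y" "- x"] sublinear_scaleR[OF q, of t y] by simp
    qed
    have "sublinear (\<lambda>x. Inf (S x))"
    proof (rule sublinear_Inf[OF _ bdd])
      show "S x \<noteq> {}" for x by (auto simp: S_def)
    next
      fix x1 x2 a b assume "a \<in> S x1" "b \<in> S x2"
      then obtain t s where ts: "0 \<le> t" "a = q (x1 + t *\<^sub>R y) - t * q y"
        "0 \<le> s" "b = q (x2 + s *\<^sub>R y) - s * q y" by (auto simp: S_def)
      have "q (x1 + x2 + (t + s) *\<^sub>R y) \<le> q (x1 + t *\<^sub>R y) + q (x2 + s *\<^sub>R y)"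
        using sublinear_add[OF q, of "x1 + t *\<^sub>R y" "x2 + s *\<^sub>R y"] by (simp add: algebra_simps)
      then show "\<exists>k\<in>S (x1 + x2). k \<le> a + b"
        using ts unfolding S_def by (intro bexI[OF _ imageI[of "t + s"]]) (auto simp: algebra_simps)
    next
      fix x a and c :: real assume c: "0 < c" and "a \<in> S x"
      then obtain t where t: "0 \<le> t" "a = q (x + t *\<^sub>R y) - t * q y" by (auto simp: S_def)
      have "q (c *\<^sub>R x + (c * t) *\<^sub>R y) = c * q (x + t *\<^sub>R y)"
        using sublinear_scaleR[OF q, of c "x + t *\<^sub>R y"] c by (simp add: scaleR_add_right)
      then have "q (c *\<^sub>R x + (c * t) *\<^sub>R y) - c * t * q y = c * a"
        using t by (simp add: right_diff_distrib)
      then show "\<exists>k\<in>S (c *\<^sub>R x). k \<le> c * a"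
        using t c unfolding S_def by (intro bexI[OF _ imageI[of "c * t"]]) auto
    qed
    moreover have low: "Inf (S x) \<le> q (x + t *\<^sub>R y) - t * q y" if "0 \<le> t" for x t
      using that by (auto simp: S_def intro!: cInf_lower bdd[unfolded S_def])
    from low[of 0] have "(\<lambda>x. Inf (S x)) \<le> q" by (simp add: le_fun_def)
    ultimately have "(\<lambda>x. Inf (S x)) = q" by (rule minimal)
    then show ?thesis using low[of 1 x] by (simp add: fun_eq_iff)
  qed
  have add: "q (x + y) = q x + q y" for x y
    using super sublinear_add[OF q] by (intro antisym)
  have minus: "q (- x) = - q x" for x
    using add[of x "- x"] sublinear_zero[OF q] by simp
  have "q (c *\<^sub>R x) = c * q x" for c x
    using sublinear_scaleR[OF q, of c x] sublinear_scaleR[OF q, of "- c" x] minus[of "c *\<^sub>R x"]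
    by (cases "0 \<le> c") auto
  with add show ?thesis by (intro linearI) auto
qed

text \<open>The Hahn-Banach theorem in its simplest form, where no functional is prescribed on a
  subspace.\<close>

lemma sublinear_dominates_linear:
  fixes P :: "'a::real_vector \<Rightarrow> real"
  assumes "sublinear P"
  obtains \<phi> where "linear \<phi>" "\<And>x. \<phi> x \<le> P x"
  using exists_minimal_sublinear[OF assms] minimal_sublinear_imp_linear
  by (metis le_funD)

section \<open>Affine minorants of convex functions\<close>

definition seminorm :: "('a::real_vector \<Rightarrow> real) \<Rightarrow> bool" where
  "seminorm p \<longleftrightarrow> (\<forall>x y. p (x + y) \<le> p x + p y) \<and> (\<forall>c x. p (c *\<^sub>R x) = \<bar>c\<bar> * p x)"

lemma seminorm_minus: "seminorm p \<Longrightarrow> p (- x) = p x"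
  by (metis (no_types) abs_minus_cancel abs_one mult_1 scaleR_minus1_left seminorm_def)

lemma seminorm_zero: "seminorm p \<Longrightarrow> p 0 = 0"
  by (metis abs_zero mult_zero_left scaleR_zero_left seminorm_def)

lemma seminorm_nonneg: "seminorm p \<Longrightarrow> 0 \<le> p x"
proof -
  assume p: "seminorm p"
  then have "p (x + - x) \<le> p x + p (- x)" unfolding seminorm_def by blast
  then show ?thesis using seminorm_zero[OF p] seminorm_minus[OF p, of x] by simp
qed

lemma convex_ereal_combination:
  assumes "convex_ereal h" "h x \<le> ereal a" "h y \<le> ereal b" "0 \<le> u" "0 \<le> v" "u + v = 1"
  shows "h (u *\<^sub>R x + v *\<^sub>R y) \<le> ereal (u * a + v * b)"
proof -
  have "h (u *\<^sub>R x + v *\<^sub>R y) \<le> ereal u * h x + ereal v * h y"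
    using assms unfolding convex_ereal_def by blast
  also have "\<dots> \<le> ereal u * ereal a + ereal v * ereal b"
    using assms by (intro add_mono ereal_mult_left_mono) auto
  finally show ?thesis by simp
qed

text \<open>A sandwich theorem: an affine function fits between the concave function \<open>r - p\<close> and a convex
  function above it. With \<open>c\<close> ranging over the real upper bounds of \<open>h (x0 + v)\<close>, the function
  \<open>u \<mapsto> Inf {p (u - t v) + t (c - r) | t \<ge> 0}\<close> is the largest sublinear function below both
  \<open>p\<close> and the increments \<open>v \<mapsto> h (x0 + v) - r\<close>; convexity of \<open>h\<close> makes it subadditive, and the
  bound \<open>r - p \<le> h\<close> keeps it above \<open>- p\<close>. Any linear functional below it gives the minorant.

  The statement lives in an arbitrary real vector space. It is applied below both to functions on the
  space of the optimization problem and, with \<open>h\<close> the indicator function of a convex set, to the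
  dual side.\<close>

lemma affine_minorant:
  fixes h :: "'a::real_vector \<Rightarrow> ereal"
  assumes h: "convex_ereal h" "h x1 < \<infinity>"
    and p: "seminorm p"
    and bound: "\<And>v. ereal (r - p v) \<le> h (x0 + v)"
  obtains \<phi> where "linear \<phi>" "\<And>v. \<phi> v \<le> p v" "\<And>v. ereal (r + \<phi> v) \<le> h (x0 + v)"
proof -
  have padd: "p (x + y) \<le> p x + p y" and pscale: "p (c *\<^sub>R x) = \<bar>c\<bar> * p x" for x y c
    using p by (auto simp: seminorm_def)
  define S where "S x = {p (x - t *\<^sub>R v) + t * (c - r) | t v c. 0 \<le> t \<and> h (x0 + v) \<le> ereal c}" for x
  have S_I: "p (x - t *\<^sub>R v) + t * (c - r) \<in> S x" if "0 \<le> t" "h (x0 + v) \<le> ereal c" for x t v c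
    using that by (auto simp: S_def)
  obtain v0 c0 where v0: "h (x0 + v0) \<le> ereal c0"
  proof -
    have "h (x0 + (x1 - x0)) < \<infinity>" using h by simp
    then show ?thesis using that by (metis ereal_dense2 less_imp_le)
  qed
  have bdd: "bdd_below (S x)" for x
  proof (rule bdd_belowI)
    fix a assume "a \<in> S x"
    then obtain t v c where t: "0 \<le> t" "h (x0 + v) \<le> ereal c" "a = p (x - t *\<^sub>R v) + t * (c - r)"
      by (auto simp: S_def)
    have "r - p v \<le> c" using bound[of v] t(2) order_trans by fastforce
    then have "t * (- p v) \<le> t * (c - r)" using t(1) by (intro mult_left_mono) auto
    moreover have "p (t *\<^sub>R v) \<le> p (x - t *\<^sub>R v) + p x"
      using padd[of "t *\<^sub>R v - x" x] seminorm_minus[OF p, of "t *\<^sub>R v - x"] by simp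
    ultimately show "- p x \<le> a" using t pscale[of t v] by simp
  qed
  have "sublinear (\<lambda>x. Inf (S x))"
  proof (rule sublinear_Inf[OF _ bdd])
    show "S x \<noteq> {}" for x using S_I[OF order_refl v0] by blast
  next
    fix x y a b assume "a \<in> S x" "b \<in> S y"
    then obtain t v c s w d where
      t: "0 \<le> t" "h (x0 + v) \<le> ereal c" "a = p (x - t *\<^sub>R v) + t * (c - r)" and
      s: "0 \<le> s" "h (x0 + w) \<le> ereal d" "b = p (y - s *\<^sub>R w) + s * (d - r)"
      by (auto simp: S_def)
    \<comment> \<open>The two scaled points are merged into one by convexity; for \<open>t = s = 0\<close> any point will do.\<close>
    obtain v' c' where v': "h (x0 + v') \<le> ereal c'"
      and eq: "(t + s) *\<^sub>R v' = t *\<^sub>R v + s *\<^sub>R w" "(t + s) * c' = t * c + s * d"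
    proof (cases "t + s = 0")
      case True
      then show ?thesis using t s that[OF t(2)] by (simp add: add_nonneg_eq_0_iff)
    next
      case False
      define u where "u = t / (t + s)"
      define u' where "u' = s / (t + s)"
      have u: "0 \<le> u" "0 \<le> u'" "u + u' = 1" "(t + s) * u = t" "(t + s) * u' = s"
        using False t(1) s(1) by (auto simp: u_def u'_def add_divide_distrib[symmetric])
      have "h (u *\<^sub>R (x0 + v) + u' *\<^sub>R (x0 + w)) \<le> ereal (u * c + u' * d)"
        by (rule convex_ereal_combination[OF h(1) t(2) s(2) u(1-3)])
      also have "u *\<^sub>R (x0 + v) + u' *\<^sub>R (x0 + w) = (u + u') *\<^sub>R x0 + (u *\<^sub>R v + u' *\<^sub>R w)"
        by (simp add: algebra_simps)
      finally show ?thesis using u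
        by (intro that[of "u *\<^sub>R v + u' *\<^sub>R w" "u * c + u' * d"])
          (simp_all add: scaleR_add_right distrib_left mult.assoc[symmetric])
    qed
    have "p (x + y - (t + s) *\<^sub>R v') \<le> p (x - t *\<^sub>R v) + p (y - s *\<^sub>R w)"
      using padd[of "x - t *\<^sub>R v" "y - s *\<^sub>R w"] unfolding eq(1) by (simp add: algebra_simps)
    moreover have "(t + s) * (c' - r) = t * (c - r) + s * (d - r)"
      using eq(2) by (simp add: algebra_simps)
    ultimately show "\<exists>k\<in>S (x + y). k \<le> a + b"
      using t s by (intro bexI[OF _ S_I[OF _ v', of "t + s"]]) auto
  next
    fix x a and k :: real assume k: "0 < k" and "a \<in> S x"
    then obtain t v c where
      t: "0 \<le> t" "h (x0 + v) \<le> ereal c" "a = p (x - t *\<^sub>R v) + t * (c - r)"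
      by (auto simp: S_def)
    have "p (k *\<^sub>R x - (k * t) *\<^sub>R v) = k * p (x - t *\<^sub>R v)"
      using pscale[of k "x - t *\<^sub>R v"] k by (simp add: scaleR_diff_right)
    then have "p (k *\<^sub>R x - (k * t) *\<^sub>R v) + k * t * (c - r) = k * a"
      by (simp add: t(3) distrib_left mult.assoc)
    then show "\<exists>l\<in>S (k *\<^sub>R x). l \<le> k * a"
      using S_I[OF _ t(2), of "k * t" "k *\<^sub>R x"] t(1) k by (metis less_imp_le mult_nonneg_nonneg order_refl)
  qed
  then obtain \<phi> where \<phi>: "linear \<phi>" "\<And>x. \<phi> x \<le> Inf (S x)"
    using sublinear_dominates_linear by blast
  have le: "\<phi> x \<le> p (x - t *\<^sub>R v) + t * (c - r)" if "0 \<le> t" "h (x0 + v) \<le> ereal c" for x t v c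
    using order_trans[OF \<phi>(2) cInf_lower[OF S_I[OF that] bdd]] .
  show ?thesis
  proof (rule that[OF \<phi>(1)])
    show "\<phi> v \<le> p v" for v using le[OF order_refl v0, of v] by simp
    fix v
    show "ereal (r + \<phi> v) \<le> h (x0 + v)"
    proof (rule ereal_le_real)
      fix c assume "h (x0 + v) \<le> ereal c"
      then show "ereal (r + \<phi> v) \<le> ereal c"
        using le[of 1 v c v] seminorm_zero[OF p] by simp
    qed
  qed
qed

section \<open>Continuous seminorms on locally convex spaces\<close>

lemma tendsto_scaleR_locally_convex:
  fixes x :: "'a::locally_convex_t2"
  assumes "(f \<longlongrightarrow> a) F" "(g \<longlongrightarrow> x) F"
  shows "((\<lambda>z. f z *\<^sub>R g z) \<longlongrightarrow> a *\<^sub>R x) F"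
  using filterlim_compose[OF tendsto_scaleR_Pair filterlim_Pair[OF assms]] by simp

text \<open>The Minkowski gauge of a convex symmetric neighbourhood \<open>W\<close> contained in \<open>U\<close>. Continuity of
  the scalar multiplication is used twice: in the scalar, to see that \<open>W\<close> absorbs every vector, so
  that the gauge is finite, and in the vector, to see that the gauge is small near \<open>0\<close>.\<close>

lemma exists_continuous_seminorm:
  fixes U :: "'a::locally_convex_t2 set"
  assumes "open U" "0 \<in> U"
  obtains p where "seminorm p" "(p \<longlongrightarrow> 0) (nhds 0)" "\<And>v. p v < 1 \<Longrightarrow> v \<in> U"
proof -
  obtain V where V: "open V" "0 \<in> V" "V \<subseteq> U" "convex V"
    using locally_convex_0_convex[OF assms] by blast
  define W where "W = V \<inter> uminus -` V"
  have W_nhds: "eventually (\<lambda>v. v \<in> W) (nhds 0)"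
  proof -
    have "eventually (\<lambda>v. v \<in> V) (nhds (0::'a))" using V by (simp add: eventually_nhds_in_open)
    moreover have "(uminus \<longlongrightarrow> - (0::'a)) (nhds 0)" by (rule tendsto_uminus_nhds)
    then have "eventually (\<lambda>v. - v \<in> V) (nhds (0::'a))"
      using V by (intro topological_tendstoD) auto
    ultimately show ?thesis by eventually_elim (simp add: W_def)
  qed
  have W: "0 \<in> W" "W \<subseteq> U" "- v \<in> W \<longleftrightarrow> v \<in> W" for v using V by (auto simp: W_def)
  have W_conv: "a *\<^sub>R x + b *\<^sub>R y \<in> W" if "x \<in> W" "y \<in> W" "0 \<le> a" "0 \<le> b" "a + b = 1" for a b x y
  proof -
    have "a *\<^sub>R (- x) + b *\<^sub>R (- y) \<in> V" "a *\<^sub>R x + b *\<^sub>R y \<in> V"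
      using that convexD[OF V(4)] by (auto simp: W_def simp del: scaleR_minus_right)
    then show ?thesis by (simp add: W_def)
  qed
  define S where "S v = {t. 0 < t \<and> (1 / t) *\<^sub>R v \<in> W}" for v
  define p where "p v = Inf (S v)" for v
  have bdd: "bdd_below (S v)" for v by (rule bdd_belowI[of _ 0]) (simp add: S_def)
  have ne: "S v \<noteq> {}" for v
  proof -
    have "((\<lambda>c. c *\<^sub>R v) \<longlongrightarrow> 0 *\<^sub>R v) (at_right 0)"
      by (intro tendsto_scaleR_locally_convex tendsto_const tendsto_ident_at)
    then have "filterlim (\<lambda>c. c *\<^sub>R v) (nhds 0) (at_right 0)" by simp
    with W_nhds have "eventually (\<lambda>c. c *\<^sub>R v \<in> W) (at_right 0)"
      by (rule eventually_compose_filterlim)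
    moreover have "eventually (\<lambda>c::real. 0 < c) (at_right 0)" by (simp add: eventually_at_right_less)
    ultimately have "eventually (\<lambda>c. c *\<^sub>R v \<in> W \<and> 0 < c) (at_right 0)" by eventually_elim simp
    then obtain c where "c *\<^sub>R v \<in> W" "0 < c"
      using eventually_happens' trivial_limit_at_right_real by blast
    then have "1 / c \<in> S v" by (simp add: S_def)
    then show ?thesis by blast
  qed
  have sub: "sublinear p" unfolding p_def
  proof (rule sublinear_Inf[OF ne bdd])
    fix x y a b assume "a \<in> S x" "b \<in> S y"
    then have ab: "0 < a" "0 < b" "(1 / a) *\<^sub>R x \<in> W" "(1 / b) *\<^sub>R y \<in> W" by (auto simp: S_def)
    have "(a / (a + b)) *\<^sub>R (1 / a) *\<^sub>R x + (b / (a + b)) *\<^sub>R (1 / b) *\<^sub>R y \<in> W"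
      using ab by (intro W_conv) (auto simp: add_divide_distrib[symmetric])
    then have "(1 / (a + b)) *\<^sub>R (x + y) \<in> W" using ab by (simp add: scaleR_add_right)
    then have "a + b \<in> S (x + y)" using ab by (simp add: S_def)
    then show "\<exists>k\<in>S (x + y). k \<le> a + b" by blast
  next
    fix x a and c :: real assume "0 < c" "a \<in> S x"
    then have "c * a \<in> S (c *\<^sub>R x)" by (simp add: S_def)
    then show "\<exists>k\<in>S (c *\<^sub>R x). k \<le> c * a" by blast
  qed
  have even: "p (- v) = p v" for v by (simp add: p_def S_def W)
  have nonneg: "0 \<le> p v" for v
    unfolding p_def by (rule cInf_greatest[OF ne]) (simp add: S_def)
  show ?thesis
  proof (rule that)
    have "p (c *\<^sub>R x) = \<bar>c\<bar> * p x" for c x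
      using sublinear_scaleR[OF sub, of "\<bar>c\<bar>" x] even[of "c *\<^sub>R x"] by (cases "0 \<le> c") auto
    then show "seminorm p" using sub by (simp add: seminorm_def sublinear_def)
    show "v \<in> U" if less: "p v < 1" for v
    proof -
      obtain t where "t \<in> S v" "t < 1"
        using cInf_lessD[OF ne less[unfolded p_def]] by blast
      then have "t *\<^sub>R (1 / t) *\<^sub>R v + (1 - t) *\<^sub>R 0 \<in> W" "0 < t"
        using W(1) by (auto simp: S_def intro!: W_conv simp del: scaleR_scaleR scaleR_zero_right)
      then show ?thesis using W(2) by auto
    qed
    show "(p \<longlongrightarrow> 0) (nhds 0)"
    proof (rule order_tendstoI)
      show "eventually (\<lambda>v. a < p v) (nhds 0)" if "a < 0" for a
        using that nonneg by (auto intro!: always_eventually elim: less_le_trans)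
      fix e :: real assume e: "0 < e"
      have "((\<lambda>v. (2 / e) *\<^sub>R v) \<longlongrightarrow> (2 / e) *\<^sub>R 0) (nhds (0::'a))"
        by (intro tendsto_scaleR_locally_convex tendsto_const filterlim_ident)
      then have "filterlim (\<lambda>v. (2 / e) *\<^sub>R v) (nhds 0) (nhds (0::'a))" by simp
      with W_nhds have "eventually (\<lambda>v. (2 / e) *\<^sub>R v \<in> W) (nhds 0)"
        by (rule eventually_compose_filterlim)
      then show "eventually (\<lambda>v. p v < e) (nhds 0)"
      proof eventually_elim
        case (elim v)
        then have "e / 2 \<in> S v" using e by (simp add: S_def)
        then have "p v \<le> e / 2" unfolding p_def by (rule cInf_lower[OF _ bdd])
        with e show ?case by simp
      qed
    qed
  qed
qed

lemma seminorm_bounded_linear_in_dual: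
  fixes \<phi> :: "'a::locally_convex_t2 \<Rightarrow> real"
  assumes \<phi>: "linear \<phi>" "\<And>v. \<phi> v \<le> p v" and p: "seminorm p" "(p \<longlongrightarrow> 0) (nhds 0)"
  shows "\<phi> \<in> topological_dual"
proof -
  have abs: "\<bar>\<phi> v\<bar> \<le> p v" for v
    using \<phi>(2)[of v] \<phi>(2)[of "- v"] seminorm_minus[OF p(1), of v] linear_neg[OF \<phi>(1), of v] by simp
  have "(\<phi> \<longlongrightarrow> \<phi> x) (at x)" for x
  proof -
    have "((\<lambda>y. y - x) \<longlongrightarrow> x - x) (at x)" by (intro tendsto_diff tendsto_ident_at tendsto_const)
    then have "((\<lambda>y. p (y - x)) \<longlongrightarrow> 0) (at x)"
      by (intro filterlim_compose[OF p(2)]) simp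
    then have "((\<lambda>y. \<phi> (y - x)) \<longlongrightarrow> 0) (at x)"
      by (rule Lim_null_comparison[rotated]) (simp add: abs)
    then show ?thesis
      by (subst (asm) linear_diff[OF \<phi>(1)]) (rule LIM_zero_cancel)
  qed
  then show ?thesis
    using \<phi>(1) by (simp add: topological_dual_def continuous_on_def)
qed

section \<open>Epigraphs of conjugates of proper convex lower semicontinuous functions\<close>

text \<open>The points of the epigraph of the conjugate are the continuous affine minorants
  \<open>x \<mapsto> \<phi> x - s\<close> of the function.\<close>

lemma mem_epi_conjugate_iff:
  "(\<phi>, s) \<in> epi_conjugate h \<longleftrightarrow> \<phi> \<in> topological_dual \<and> (\<forall>x. ereal (\<phi> x - s) \<le> h x)"
proof -
  have "ereal (\<phi> x) - h x \<le> ereal s \<longleftrightarrow> ereal (\<phi> x - s) \<le> h x" for x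
    by (cases "h x") auto
  then show ?thesis by (simp add: epi_conjugate_def conjugate_def SUP_le_iff)
qed

lemma epi_conjugate_through_seminorm_bound:
  fixes h :: "'a::locally_convex_t2 \<Rightarrow> ereal"
  assumes h: "h \<in> proper_convex_lsc"
    and p: "seminorm p" "(p \<longlongrightarrow> 0) (nhds 0)"
    and bound: "\<And>v. ereal (r - p v) \<le> h (x + v)"
  obtains \<phi> where "(\<phi>, \<phi> x - r) \<in> epi_conjugate h"
proof -
  obtain z where "convex_ereal h" "h z < \<infinity>"
    using h by (auto simp: proper_convex_lsc_def effective_domain_def)
  from affine_minorant[OF this p(1) bound]
  obtain \<phi> where \<phi>: "linear \<phi>" "\<And>v. \<phi> v \<le> p v" "\<And>v. ereal (r + \<phi> v) \<le> h (x + v)" by blast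
  have "ereal (\<phi> y - (\<phi> x - r)) \<le> h y" for y
    using \<phi>(3)[of "y - x"] linear_diff[OF \<phi>(1), of y x] by (simp add: algebra_simps)
  with seminorm_bounded_linear_in_dual[OF \<phi>(1,2) p] show ?thesis
    by (intro that[of \<phi>]) (simp add: mem_epi_conjugate_iff)
qed

lemma lsc_seminorm_ball:
  fixes h :: "'a::locally_convex_t2 \<Rightarrow> ereal"
  assumes "lower_semicontinuous h" "ereal r < h x"
  obtains p where "seminorm p" "(p \<longlongrightarrow> 0) (nhds 0)" "\<And>v. p v < 1 \<Longrightarrow> ereal r < h (x + v)"
proof -
  have "((\<lambda>v. x + v) \<longlongrightarrow> x + 0) (nhds 0)" by (intro tendsto_add tendsto_const filterlim_ident)
  then have "filterlim (\<lambda>v. x + v) (nhds x) (nhds 0)" by simp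
  moreover have "eventually (\<lambda>y. ereal r < h y) (nhds x)"
    using assms by (simp add: lower_semicontinuous_def)
  ultimately have "eventually (\<lambda>v. ereal r < h (x + v)) (nhds 0)"
    by (rule eventually_compose_filterlim[rotated])
  then obtain U where "open U" "0 \<in> U" "\<And>v. v \<in> U \<Longrightarrow> ereal r < h (x + v)"
    by (auto simp: eventually_nhds)
  then show ?thesis using that exists_continuous_seminorm[of U] by metis
qed

lemma seminorm_mult: "seminorm p \<Longrightarrow> 0 \<le> c \<Longrightarrow> seminorm (\<lambda>v. c * p v)"
  by (auto simp: seminorm_def distrib_left[symmetric] intro: mult_left_mono)

text \<open>At a point \<open>x\<close> where \<open>h\<close> is finite, lower semicontinuity keeps \<open>h\<close> above \<open>r\<close> on a unit ball
  of some continuous seminorm \<open>p\<close>, and convexity along the segment from \<open>x\<close> to \<open>x + v\<close> turns this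
  into a lower bound that decreases at most linearly in \<open>p v\<close>.\<close>

lemma exists_epi_conjugate_in_domain:
  fixes h :: "'a::locally_convex_t2 \<Rightarrow> ereal"
  assumes h: "h \<in> proper_convex_lsc" and a: "h x = ereal a" and r: "r < a"
  obtains \<phi> where "(\<phi>, \<phi> x - r) \<in> epi_conjugate h"
proof -
  have lsc: "lower_semicontinuous h" and conv: "convex_ereal h" and minf: "\<And>y. h y \<noteq> -\<infinity>"
    using h by (auto simp: proper_convex_lsc_def)
  obtain p where p: "seminorm p" "(p \<longlongrightarrow> 0) (nhds 0)" "\<And>v. p v < 1 \<Longrightarrow> ereal r < h (x + v)"
    using lsc_seminorm_ball[OF lsc, of r x] a r by auto
  define N where "N = 2 * (a - r)"
  have "ereal (r - N * p v) \<le> h (x + v)" for v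
  proof (cases "p v < 1")
    case True
    moreover have "0 \<le> N * p v" using r seminorm_nonneg[OF p(1)] by (simp add: N_def)
    then have "ereal (r - N * p v) \<le> ereal r" by simp
    ultimately show ?thesis using p(3) less_imp_le order_trans by blast
  next
    case False
    \<comment> \<open>The point \<open>x + u v\<close> lies strictly inside the unit ball, at seminorm distance \<open>1 / 2\<close>.\<close>
    define u where "u = 1 / (2 * p v)"
    have u: "0 < u" "u \<le> 1" "p (u *\<^sub>R v) = 1 / 2" "1 / u = 2 * p v"
      using False p(1) by (auto simp: u_def seminorm_def divide_simps)
    show ?thesis
    proof (rule ereal_le_real)
      fix b assume b: "h (x + v) \<le> ereal b"
      have "ereal r < h (x + u *\<^sub>R v)" using p(3) u by simp
      also have "x + u *\<^sub>R v = (1 - u) *\<^sub>R x + u *\<^sub>R (x + v)" by (simp add: algebra_simps)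
      also have "h \<dots> \<le> ereal ((1 - u) * a + u * b)"
        using u a b by (intro convex_ereal_combination[OF conv]) auto
      finally have "(r - a) / u \<le> b - a" using u(1) by (simp add: divide_simps algebra_simps)
      moreover have "(r - a) / u = (r - a) * (2 * p v)" using u(4) by (simp add: divide_inverse)
      ultimately have "r - N * p v \<le> b" using r by (simp add: N_def algebra_simps)
      then show "ereal (r - N * p v) \<le> ereal b" by simp
    qed
  qed
  moreover have "((\<lambda>v. N * p v) \<longlongrightarrow> N * 0) (nhds 0)" by (intro tendsto_intros p)
  ultimately show ?thesis
    using epi_conjugate_through_seminorm_bound[OF h seminorm_mult[OF p(1), of N]] r that
    by (auto simp: N_def)
qed

text \<open>The nontrivial half of the Fenchel-Moreau theorem: \<open>h\<close> is the supremum of its continuous affine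
  minorants. Where \<open>h x = \<infinity>\<close>, the convexity argument at a point of the domain is no longer
  available. Instead, an affine minorant \<open>\<phi> - s\<close> obtained at some point \<open>z\<close> of the domain controls
  \<open>h\<close> outside the unit ball around \<open>x\<close>, at the price of adding \<open>\<bar>\<phi>\<bar>\<close> to the seminorm.\<close>

lemma exists_epi_conjugate:
  fixes h :: "'a::locally_convex_t2 \<Rightarrow> ereal"
  assumes h: "h \<in> proper_convex_lsc" and r: "ereal r < h x"
  obtains \<phi> where "(\<phi>, \<phi> x - r) \<in> epi_conjugate h"
proof -
  obtain z a where "h z = ereal a"
    using h by (auto simp: proper_convex_lsc_def effective_domain_def) (metis ereal_cases less_irrefl)
  then obtain \<phi> where "(\<phi>, \<phi> z - (a - 1)) \<in> epi_conjugate h"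
    using exists_epi_conjugate_in_domain[OF h, of z a "a - 1"] by auto
  then obtain s where \<phi>: "linear \<phi>" "continuous_on UNIV \<phi>" "\<And>y. ereal (\<phi> y - s) \<le> h y"
    by (auto simp: mem_epi_conjugate_iff topological_dual_def)
  obtain p where p: "seminorm p" "(p \<longlongrightarrow> 0) (nhds 0)" "\<And>v. p v < 1 \<Longrightarrow> ereal r < h (x + v)"
    using lsc_seminorm_ball[of h r x] h r by (auto simp: proper_convex_lsc_def)
  define N where "N = \<bar>r - (\<phi> x - s)\<bar>"
  define P where "P v = \<bar>\<phi> v\<bar> + N * p v" for v
  have Np: "seminorm (\<lambda>v. N * p v)" using p(1) by (rule seminorm_mult) (simp add: N_def)
  have "seminorm P"
    unfolding seminorm_def P_def
  proof (intro conjI allI)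
    fix v w and c :: real
    show "\<bar>\<phi> (v + w)\<bar> + N * p (v + w) \<le> \<bar>\<phi> v\<bar> + N * p v + (\<bar>\<phi> w\<bar> + N * p w)"
      using Np linear_add[OF \<phi>(1), of v w] unfolding seminorm_def
      by (smt (verit))
    show "\<bar>\<phi> (c *\<^sub>R v)\<bar> + N * p (c *\<^sub>R v) = \<bar>c\<bar> * (\<bar>\<phi> v\<bar> + N * p v)"
      using p(1) linear_scale[OF \<phi>(1), of c v] by (simp add: seminorm_def abs_mult algebra_simps)
  qed
  moreover have "(P \<longlongrightarrow> 0) (nhds 0)"
  proof -
    have "(\<phi> \<longlongrightarrow> \<phi> 0) (nhds 0)"
      using \<phi>(2) by (simp add: continuous_on_def tendsto_at_iff_tendsto_nhds)
    then have "((\<lambda>v. \<bar>\<phi> v\<bar> + N * p v) \<longlongrightarrow> \<bar>\<phi> 0\<bar> + N * 0) (nhds 0)"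
      by (intro tendsto_intros p)
    then show ?thesis using linear_0[OF \<phi>(1)] unfolding P_def by simp
  qed
  moreover have "ereal (r - P v) \<le> h (x + v)" for v
  proof (cases "p v < 1")
    case True
    have "0 \<le> P v" using seminorm_nonneg[OF Np] by (simp add: P_def)
    then have "ereal (r - P v) \<le> ereal r" by simp
    then show ?thesis using p(3)[OF True] less_imp_le order_trans by blast
  next
    case False
    then have "N * 1 \<le> N * p v" by (intro mult_left_mono) (auto simp: N_def)
    then have "r - P v \<le> \<phi> (x + v) - s"
      using linear_add[OF \<phi>(1), of x v] by (simp add: P_def N_def)
    then have "ereal (r - P v) \<le> ereal (\<phi> (x + v) - s)" by simp
    then show ?thesis using \<phi>(3) order_trans by blast
  qed
  ultimately show ?thesis using epi_conjugate_through_seminorm_bound[OF h] that by blast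
qed

lemma lower_semicontinuous_add:
  assumes "lower_semicontinuous f" "lower_semicontinuous g" "\<And>x. f x \<noteq> -\<infinity>" "\<And>x. g x \<noteq> -\<infinity>"
  shows "lower_semicontinuous (\<lambda>x. f x + g x)"
  unfolding lower_semicontinuous_def
proof (intro allI impI)
  fix x r assume r: "r < f x + g x"
  have "\<exists>a b. r \<le> ereal (a + b) \<and> ereal a < f x \<and> ereal b < g x"
  proof -
    obtain r' where r': "r < ereal r'" "ereal r' < f x + g x" using ereal_dense2[OF r] by blast
    show ?thesis
    proof (cases "f x")
      case (real c)
      then have "ereal (r' - c) < g x" using r'(2) by (cases "g x") auto
      then obtain b where b: "ereal (r' - c) < ereal b" "ereal b < g x" using ereal_dense2 by blast
      then show ?thesis using real r'(1) less_imp_le[OF r'(1)]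
        by (intro exI[of _ "r' - b"] exI[of _ b]) auto
    next
      case PInf
      obtain b where "ereal b < g x" using assms(4) by (metis ereal_dense2 ereal_infty_less(2))
      then show ?thesis using PInf less_imp_le[OF r'(1)]
        by (intro exI[of _ "r' - b"] exI[of _ b]) auto
    qed (use assms in auto)
  qed
  then obtain a b where ab: "r \<le> ereal (a + b)" "ereal a < f x" "ereal b < g x" by blast
  then have "eventually (\<lambda>y. ereal a < f y) (nhds x)" "eventually (\<lambda>y. ereal b < g y) (nhds x)"
    using assms by (auto simp: lower_semicontinuous_def)
  then show "eventually (\<lambda>y. r < f y + g y) (nhds x)"
  proof eventually_elim
    case (elim y)
    then have "ereal a + ereal b < f y + g y" by (rule ereal_add_strict_mono2)
    with ab(1) show ?case by simp
  qed
qed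

lemma proper_convex_lsc_add_scaled:
  assumes f: "f \<in> proper_convex_lsc" and g: "g \<in> proper_convex_lsc"
    and z: "f z < \<infinity>" "g z < \<infinity>" and c: "0 < c"
  shows "(\<lambda>x. f x + ereal c * g x) \<in> proper_convex_lsc"
proof -
  note fg = f[unfolded proper_convex_lsc_def] g[unfolded proper_convex_lsc_def]
  have cg: "ereal c * g x \<noteq> -\<infinity>" for x using fg c by (cases "g x") auto
  have "lower_semicontinuous (\<lambda>x. ereal c * g x)"
    unfolding lower_semicontinuous_def
  proof (intro allI impI)
    fix x r assume "r < ereal c * g x"
    moreover have iff: "r < ereal c * g y \<longleftrightarrow> r / ereal c < g y" for y
      using c by (cases r; cases "g y") (auto simp: divide_simps mult.commute)
    ultimately have "r / ereal c < g x" by simp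
    then show "eventually (\<lambda>y. r < ereal c * g y) (nhds x)"
      using fg unfolding iff lower_semicontinuous_def by blast
  qed
  then have "lower_semicontinuous (\<lambda>x. f x + ereal c * g x)"
    using fg cg by (intro lower_semicontinuous_add) auto
  moreover have "f z + ereal c * g z < \<infinity>" using z c fg by (cases "f z"; cases "g z") auto
  then have "effective_domain (\<lambda>x. f x + ereal c * g x) \<noteq> {}" by (auto simp: effective_domain_def)
  moreover have "convex_ereal (\<lambda>x. f x + ereal c * g x)"
    unfolding convex_ereal_def
  proof (intro allI impI)
    fix x y and u v :: real assume uv: "0 \<le> u" "0 \<le> v" "u + v = 1"
    have "f (u *\<^sub>R x + v *\<^sub>R y) \<le> ereal u * f x + ereal v * f y"
      "g (u *\<^sub>R x + v *\<^sub>R y) \<le> ereal u * g x + ereal v * g y"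
      using fg uv by (auto simp: convex_ereal_def)
    then have "f (u *\<^sub>R x + v *\<^sub>R y) + ereal c * g (u *\<^sub>R x + v *\<^sub>R y)
       \<le> (ereal u * f x + ereal v * f y) + ereal c * (ereal u * g x + ereal v * g y)"
      using c by (intro add_mono ereal_mult_left_mono) auto
    also have "\<dots> = ereal u * (f x + ereal c * g x) + ereal v * (f y + ereal c * g y)"
    proof (cases "u = 0 \<or> v = 0")
      case True
      then show ?thesis using uv by (auto simp flip: zero_ereal_def)
    next
      case False
      moreover have "f x \<noteq> -\<infinity>" "f y \<noteq> -\<infinity>" "g x \<noteq> -\<infinity>" "g y \<noteq> -\<infinity>" using fg by auto
      ultimately show ?thesis using uv c
        by (cases "f x"; cases "f y"; cases "g x"; cases "g y") (auto simp: algebra_simps)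
    qed
    finally show "f (u *\<^sub>R x + v *\<^sub>R y) + ereal c * g (u *\<^sub>R x + v *\<^sub>R y)
       \<le> ereal u * (f x + ereal c * g x) + ereal v * (f y + ereal c * g y)" .
  qed
  moreover have "f x + ereal c * g x \<noteq> -\<infinity>" for x
    using fg cg[of x] by (cases "f x"; cases "ereal c * g x") auto
  ultimately show ?thesis by (simp add: proper_convex_lsc_def)
qed

section \<open>Separation in the weak-star topology\<close>

text \<open>The pointwise vector space structure makes the sandwich theorem applicable to sets of
  functionals.\<close>

instantiation "fun" :: (type, real_vector) real_vector
begin

definition "c *\<^sub>R (f :: 'a \<Rightarrow> 'b) = (\<lambda>x. c *\<^sub>R f x)"

instance
  by standard (simp_all add: scaleR_fun_def fun_eq_iff scaleR_add_right scaleR_add_left)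

end

lemma scaleR_fun_apply [simp]: "(c *\<^sub>R f) x = c *\<^sub>R f x"
  by (simp add: scaleR_fun_def)

lemma sum_fun_apply: "(\<Sum>y\<in>F. f y) x = (\<Sum>y\<in>F. f y x)"
  by (induction F rule: infinite_finite_induct) auto

text \<open>The basic neighbourhoods of the topology of pointwise convergence only restrict finitely many
  coordinates.\<close>

lemma not_in_closure_imp_coordinate_gap:
  fixes A :: "(('a \<Rightarrow> real) \<times> real) set"
  assumes "(\<phi>, r) \<notin> closure A"
  obtains F \<epsilon> where "finite F" "0 < \<epsilon>"
    "\<And>\<psi> s. (\<psi>, s) \<in> A \<Longrightarrow> \<epsilon> \<le> (\<Sum>y\<in>F. \<bar>\<psi> y - \<phi> y\<bar>) + \<bar>s - r\<bar>"
proof -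
  have "open (- closure A)" "(\<phi>, r) \<in> - closure A" using assms by auto
  then obtain U V where UV: "open U" "open V" "\<phi> \<in> U" "r \<in> V" "U \<times> V \<subseteq> - closure A"
    by (rule open_prod_elim) auto
  have "openin (product_topology (\<lambda>_. euclideanreal) UNIV) U"
    using UV(1) by (simp add: euclidean_product_topology)
  from product_topology_open_contains_basis[OF this UV(3)]
  obtain X where X: "\<phi> \<in> (\<Pi>\<^sub>E i\<in>UNIV. X i)" "\<And>i. open (X i)" "finite {i. X i \<noteq> UNIV}"
    "(\<Pi>\<^sub>E i\<in>UNIV. X i) \<subseteq> U" by auto
  define F where "F = {i. X i \<noteq> UNIV}"
  have "\<exists>e>0. ball (\<phi> i) e \<subseteq> X i" for i
    using X(1,2) open_contains_ball[of "X i"] by (auto simp: PiE_iff)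
  then obtain e where e: "\<And>i. 0 < e i" "\<And>i. ball (\<phi> i) (e i) \<subseteq> X i" by metis
  obtain d where d: "0 < d" "ball r d \<subseteq> V" using UV(2,4) open_contains_ball by blast
  define \<epsilon> where "\<epsilon> = Min (insert d (e ` F))"
  have fin: "finite F" using X(3) by (simp add: F_def)
  have \<epsilon>: "0 < \<epsilon>" "\<epsilon> \<le> d" "\<And>i. i \<in> F \<Longrightarrow> \<epsilon> \<le> e i"
    using fin e(1) d(1) by (auto simp: \<epsilon>_def)
  show ?thesis
  proof (rule that[OF fin \<epsilon>(1)])
    fix \<psi> s assume A: "(\<psi>, s) \<in> A"
    show "\<epsilon> \<le> (\<Sum>y\<in>F. \<bar>\<psi> y - \<phi> y\<bar>) + \<bar>s - r\<bar>"
    proof (rule ccontr)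
      assume less: "\<not> ?thesis"
      have nn: "0 \<le> (\<Sum>y\<in>F. \<bar>\<psi> y - \<phi> y\<bar>)" by (simp add: sum_nonneg)
      have "\<bar>s - r\<bar> < d" using less nn \<epsilon>(2) by linarith
      then have "s \<in> ball r d" by (simp add: dist_real_def abs_minus_commute)
      then have "s \<in> V" using d by blast
      moreover have "\<psi> i \<in> X i" for i
      proof (cases "i \<in> F")
        case True
        then have "\<bar>\<psi> i - \<phi> i\<bar> \<le> (\<Sum>y\<in>F. \<bar>\<psi> y - \<phi> y\<bar>)"
          by (intro member_le_sum fin) auto
        then have "\<bar>\<psi> i - \<phi> i\<bar> < e i" using less \<epsilon>(3)[OF True] by linarith
        then have "\<psi> i \<in> ball (\<phi> i) (e i)" by (simp add: dist_real_def abs_minus_commute)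
        then show ?thesis using e(2) by blast
      qed (simp add: F_def)
      then have "\<psi> \<in> U" using X(4) by auto
      ultimately have "(\<psi>, s) \<in> - closure A" using UV(5) by blast
      then show False using A closure_subset[of A] by blast
    qed
  qed
qed

text \<open>The separating functional comes from the sandwich theorem for the indicator function of \<open>A\<close> and
  the seminorm that sums finitely many coordinates. A functional dominated by this seminorm depends on
  these coordinates only, so on linear functions \<open>\<psi>\<close> it is the evaluation at a linear combination
  \<open>x\<close> of the corresponding points: this is why the dual of the weak-star topology is the original
  space.\<close>

lemma weak_star_separation:
  fixes A :: "(('a::real_vector \<Rightarrow> real) \<times> real) set"
  assumes conv: "convex A" and ne: "A \<noteq> {}"
    and lin: "\<And>\<psi> s. (\<psi>, s) \<in> A \<Longrightarrow> linear \<psi>" "linear \<phi>"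
    and notin: "(\<phi>, r) \<notin> closure A"
  obtains x \<alpha> \<delta> where "0 < \<delta>"
    "\<And>\<psi> s. (\<psi>, s) \<in> A \<Longrightarrow> \<delta> \<le> \<psi> x - \<phi> x + \<alpha> * (s - r)"
proof -
  obtain F \<epsilon> where F: "finite F" "0 < \<epsilon>"
    "\<And>\<psi> s. (\<psi>, s) \<in> A \<Longrightarrow> \<epsilon> \<le> (\<Sum>y\<in>F. \<bar>\<psi> y - \<phi> y\<bar>) + \<bar>s - r\<bar>"
    using not_in_closure_imp_coordinate_gap[OF notin] by blast
  define q :: "('a \<Rightarrow> real) \<times> real \<Rightarrow> real" where "q v = (\<Sum>y\<in>F. \<bar>fst v y\<bar>) + \<bar>snd v\<bar>" for v
  have q: "seminorm q"
    unfolding seminorm_def q_def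
  proof (intro conjI allI)
    fix v w :: "('a \<Rightarrow> real) \<times> real" and c :: real
    have "(\<Sum>y\<in>F. \<bar>fst (v + w) y\<bar>) \<le> (\<Sum>y\<in>F. \<bar>fst v y\<bar> + \<bar>fst w y\<bar>)"
      by (intro sum_mono) auto
    then show "(\<Sum>y\<in>F. \<bar>fst (v + w) y\<bar>) + \<bar>snd (v + w)\<bar>
      \<le> (\<Sum>y\<in>F. \<bar>fst v y\<bar>) + \<bar>snd v\<bar> + ((\<Sum>y\<in>F. \<bar>fst w y\<bar>) + \<bar>snd w\<bar>)"
      by (simp add: sum.distrib)
    show "(\<Sum>y\<in>F. \<bar>fst (c *\<^sub>R v) y\<bar>) + \<bar>snd (c *\<^sub>R v)\<bar> = \<bar>c\<bar> * ((\<Sum>y\<in>F. \<bar>fst v y\<bar>) + \<bar>snd v\<bar>)"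
      by (simp add: abs_mult sum_distrib_left distrib_left)
  qed
  define h where "h a = (if a \<in> A then 0 else \<infinity> :: ereal)" for a
  have "convex_ereal h"
    unfolding convex_ereal_def
  proof (intro allI impI)
    fix a b and u v :: real assume uv: "0 \<le> u" "0 \<le> v" "u + v = 1"
    show "h (u *\<^sub>R a + v *\<^sub>R b) \<le> ereal u * h a + ereal v * h b"
    proof (cases "u = 0 \<or> v = 0")
      case True
      then show ?thesis using uv by (auto simp flip: zero_ereal_def)
    next
      case False
      then show ?thesis using uv convexD[OF conv, of a b u v] by (auto simp: h_def)
    qed
  qed
  moreover obtain a where "a \<in> A" using ne by blast
  then have "h a < \<infinity>" by (simp add: h_def)
  moreover have "ereal (\<epsilon> - q v) \<le> h ((\<phi>, r) + v)" for v
    using F(3)[of "\<phi> + fst v" "r + snd v"] by (cases v) (auto simp: h_def q_def)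
  ultimately obtain \<Phi> where \<Phi>: "linear \<Phi>" "\<And>v. \<Phi> v \<le> q v"
    "\<And>v. ereal (\<epsilon> + \<Phi> v) \<le> h ((\<phi>, r) + v)"
    using affine_minorant[OF _ _ q] by blast
  define e :: "'a \<Rightarrow> 'a \<Rightarrow> real" where "e y = (\<lambda>z. if z = y then 1 else 0)" for y
  define x where "x = (\<Sum>y\<in>F. (- \<Phi> (e y, 0)) *\<^sub>R y)"
  have repr: "\<Phi> (\<psi>, t) = - \<psi> x + t * \<Phi> (0, 1)" if "linear \<psi>" for \<psi> t
  proof -
    \<comment> \<open>The part of \<open>\<psi>\<close> that vanishes on \<open>F\<close>, where \<open>q\<close> and hence \<open>\<Phi>\<close> is zero.\<close>
    define w where "w = (\<psi> - (\<Sum>y\<in>F. \<psi> y *\<^sub>R e y), 0 :: real)"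
    have "q w = 0"
      unfolding q_def w_def using F(1) by (simp add: sum_fun_apply e_def mult_delta_right)
    then have "\<Phi> w = 0"
      using \<Phi>(2)[of w] \<Phi>(2)[of "- w"] linear_neg[OF \<Phi>(1), of w] seminorm_minus[OF q, of w] by simp
    moreover have "(\<psi>, t) = w + (\<Sum>y\<in>F. \<psi> y *\<^sub>R (e y, 0)) + t *\<^sub>R (0, 1)"
      by (simp add: w_def prod_eq_iff fst_sum snd_sum)
    ultimately have "\<Phi> (\<psi>, t) = (\<Sum>y\<in>F. \<psi> y * \<Phi> (e y, 0)) + t * \<Phi> (0, 1)"
      by (simp add: linear_add[OF \<Phi>(1)] linear_sum[OF \<Phi>(1)] linear_scale[OF \<Phi>(1)] del: scaleR_Pair)
    moreover have "\<psi> x = - (\<Sum>y\<in>F. \<psi> y * \<Phi> (e y, 0))"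
      by (simp add: x_def linear_sum[OF that] linear_scale[OF that] linear_neg[OF that]
          sum_negf mult.commute)
    ultimately show ?thesis by simp
  qed
  show ?thesis
  proof (rule that[OF F(2)])
    fix \<psi> s assume A: "(\<psi>, s) \<in> A"
    have "\<epsilon> + \<Phi> (\<psi> - \<phi>, s - r) \<le> 0"
      using \<Phi>(3)[of "(\<psi> - \<phi>, s - r)"] A by (simp add: h_def)
    moreover have "linear (\<psi> - \<phi>)"
      using linear_compose_sub[OF lin(1)[OF A] lin(2)] by (simp add: fun_diff_def)
    ultimately show "\<epsilon> \<le> \<psi> x - \<phi> x + (- \<Phi> (0, 1)) * (s - r)"
      by (simp add: repr mult.commute)
  qed
qed

section \<open>Lagrangians and the characteristic set\<close>

lemma mem_characteristic_set_iff:
  "(\<phi>, s) \<in> characteristic_set T f g \<longleftrightarrow> \<phi> \<in> topological_dual \<and>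
     (\<exists>l\<in>multipliers T. \<forall>x. ereal (\<phi> x - s) \<le> lagrangian f g l x)"
  by (auto simp: characteristic_set_def mem_epi_conjugate_iff)

lemma lagrangian_eq_real:
  assumes "f x = ereal c" "\<And>t. t \<in> S \<Longrightarrow> g t x = ereal (\<gamma> t)" "finite S" "{t. l t \<noteq> 0} \<subseteq> S"
  shows "lagrangian f g l x = ereal (c + (\<Sum>t\<in>S. l t * \<gamma> t))"
proof -
  have "(\<Sum>t | l t \<noteq> 0. ereal (l t) * g t x) = (\<Sum>t | l t \<noteq> 0. ereal (l t * \<gamma> t))"
    using assms by (intro sum.cong) auto
  also have "\<dots> = ereal (\<Sum>t | l t \<noteq> 0. l t * \<gamma> t)" by simp
  also have "(\<Sum>t | l t \<noteq> 0. l t * \<gamma> t) = (\<Sum>t\<in>S. l t * \<gamma> t)"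
    using assms by (intro sum.mono_neutral_left) auto
  finally show ?thesis using assms(1) by (simp add: lagrangian_def)
qed

lemma multipliers_combination:
  assumes "l \<in> multipliers T" "m \<in> multipliers T" "0 \<le> u" "0 \<le> v"
  shows "(\<lambda>t. u * l t + v * m t) \<in> multipliers T"
proof -
  have "{t. u * l t + v * m t \<noteq> 0} \<subseteq> {t. l t \<noteq> 0} \<union> {t. m t \<noteq> 0}" by auto
  with assms show ?thesis by (auto simp: multipliers_def intro: finite_subset)
qed

text \<open>On the points where everything is finite the Lagrangian is affine in the multiplier. Elsewhere the
  combined Lagrangian is infinite, because both weights are positive and so the support of the combined
  multiplier is the union of both supports.\<close>

lemma lagrangian_combination_ge:
  assumes f: "f x \<noteq> -\<infinity>" and g: "\<And>t. t \<in> T \<Longrightarrow> g t x \<noteq> -\<infinity>"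
    and l: "l \<in> multipliers T" and m: "m \<in> multipliers T"
    and uv: "0 < u" "0 < v" "u + v = 1"
    and a: "ereal a \<le> lagrangian f g l x" and b: "ereal b \<le> lagrangian f g m x"
  shows "ereal (u * a + v * b) \<le> lagrangian f g (\<lambda>t. u * l t + v * m t) x"
proof (cases "lagrangian f g (\<lambda>t. u * l t + v * m t) x = \<infinity>")
  case False
  define S where "S = {t. u * l t + v * m t \<noteq> 0}"
  have nn: "0 \<le> l t" "0 \<le> m t" for t using l m by (auto simp: multipliers_def)
  have S: "S = {t. l t \<noteq> 0} \<union> {t. m t \<noteq> 0}"
    using nn uv by (auto simp: S_def add_nonneg_eq_0_iff)
  have S': "finite S" "S \<subseteq> T" using l m by (auto simp: S multipliers_def)
  have pos: "0 < u * l t + v * m t" if "t \<in> S" for t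
    using that nn[of t] uv by (simp add: S_def order_less_le)
  from False have fin: "f x \<noteq> \<infinity>" "(\<Sum>t\<in>S. ereal (u * l t + v * m t) * g t x) \<noteq> \<infinity>"
    unfolding lagrangian_def S_def[symmetric] by auto
  obtain c where c: "f x = ereal c" using f fin(1) by (cases "f x") auto
  have "\<exists>\<gamma>. g t x = ereal \<gamma>" if "t \<in> S" for t
  proof -
    have "ereal (u * l t + v * m t) * g t x \<noteq> \<infinity>"
      using fin(2) that S'(1) by (auto simp: sum_Pinfty)
    then have "g t x \<noteq> \<infinity>" using pos[OF that] by auto
    then show ?thesis using g[of t] that S'(2) by (cases "g t x") auto
  qed
  then obtain \<gamma> where \<gamma>: "\<And>t. t \<in> S \<Longrightarrow> g t x = ereal (\<gamma> t)" by metis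
  note eq = lagrangian_eq_real[of f x c S g \<gamma>, OF c \<gamma> S'(1)]
  have "a \<le> c + (\<Sum>t\<in>S. l t * \<gamma> t)" "b \<le> c + (\<Sum>t\<in>S. m t * \<gamma> t)"
    using a b eq[of l] eq[of m] S by auto
  then have "u * a + v * b \<le> u * (c + (\<Sum>t\<in>S. l t * \<gamma> t)) + v * (c + (\<Sum>t\<in>S. m t * \<gamma> t))"
    using uv by (intro add_mono mult_left_mono) auto
  also have "\<dots> = (u + v) * c + (\<Sum>t\<in>S. (u * l t + v * m t) * \<gamma> t)"
    by (simp add: distrib_left distrib_right sum_distrib_left sum.distrib mult.assoc)
  finally show ?thesis using eq[of "\<lambda>t. u * l t + v * m t"] uv by (simp add: S_def)
qed simp

lemma convex_characteristic_set:
  assumes f: "\<And>x. f x \<noteq> -\<infinity>" and g: "\<And>t x. t \<in> T \<Longrightarrow> g t x \<noteq> -\<infinity>"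
  shows "convex (characteristic_set T f g)"
  unfolding convex_def
proof (intro ballI allI impI)
  fix p q and u v :: real
  assume p: "p \<in> characteristic_set T f g" and q: "q \<in> characteristic_set T f g"
    and uv: "0 \<le> u" "0 \<le> v" "u + v = 1"
  show "u *\<^sub>R p + v *\<^sub>R q \<in> characteristic_set T f g"
  proof (cases "u = 0 \<or> v = 0")
    case True
    then show ?thesis using p q uv by auto
  next
    case False
    then have pos: "0 < u" "0 < v" using uv by auto
    obtain \<phi> r \<psi> s where pq: "p = (\<phi>, r)" "q = (\<psi>, s)" by (metis surj_pair)
    obtain l m where l: "l \<in> multipliers T" "\<And>x. ereal (\<phi> x - r) \<le> lagrangian f g l x"
      and m: "m \<in> multipliers T" "\<And>x. ereal (\<psi> x - s) \<le> lagrangian f g m x"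
      and dual: "\<phi> \<in> topological_dual" "\<psi> \<in> topological_dual"
      using p q by (auto simp: pq mem_characteristic_set_iff)
    have "linear (\<lambda>x. u *\<^sub>R \<phi> x + v *\<^sub>R \<psi> x)"
      using dual by (intro linear_compose_add linear_compose_scale_right) (auto simp: topological_dual_def)
    moreover have "continuous_on UNIV (\<lambda>x. u *\<^sub>R \<phi> x + v *\<^sub>R \<psi> x)"
      using dual by (intro continuous_intros) (auto simp: topological_dual_def)
    ultimately have "u *\<^sub>R \<phi> + v *\<^sub>R \<psi> \<in> topological_dual"
      by (simp add: topological_dual_def plus_fun_def scaleR_fun_def)
    moreover have "ereal ((u *\<^sub>R \<phi> + v *\<^sub>R \<psi>) x - (u * r + v * s))
        \<le> lagrangian f g (\<lambda>t. u * l t + v * m t) x" for x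
      using lagrangian_combination_ge[OF f g l(1) m(1) pos uv(3) l(2) m(2), of x]
      by (simp add: algebra_simps)
    ultimately show ?thesis
      using multipliers_combination[OF l(1) m(1) uv(1,2)]
      by (auto simp: pq mem_characteristic_set_iff)
  qed
qed

lemma lagrangian_le_objective:
  assumes "l \<in> multipliers T" "x \<in> feasible_set T g"
  shows "lagrangian f g l x \<le> f x"
proof -
  have "ereal (l t) * g t x \<le> 0" if "l t \<noteq> 0" for t
  proof -
    have "0 \<le> l t" "g t x \<le> 0" using assms that by (auto simp: multipliers_def feasible_set_def)
    then show ?thesis by (cases "g t x") (auto simp: mult_nonneg_nonpos)
  qed
  then have "(\<Sum>t | l t \<noteq> 0. ereal (l t) * g t x) \<le> 0" by (intro sum_nonpos) auto
  then have "f x + (\<Sum>t | l t \<noteq> 0. ereal (l t) * g t x) \<le> f x + 0" by (intro add_left_mono)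
  then show ?thesis by (simp add: lagrangian_def)
qed

section \<open>The closure of the characteristic set\<close>

text \<open>By weak duality every point of the characteristic set satisfies the inequality, which is a closed
  condition since evaluation at \<open>x\<close> is weak-star continuous.\<close>

lemma closure_characteristic_set_le:
  assumes A: "(\<phi>, s) \<in> closure (characteristic_set T f g)" and x: "x \<in> feasible_set T g"
  shows "ereal (\<phi> x - s) \<le> f x"
proof (rule ereal_le_real)
  fix c assume c: "f x \<le> ereal c"
  have "characteristic_set T f g \<subseteq> {p. fst p x - snd p \<le> c}"
  proof
    fix p assume p: "p \<in> characteristic_set T f g"
    obtain \<psi> r where pr: "p = (\<psi>, r)" by (cases p)
    obtain l where "l \<in> multipliers T" "ereal (\<psi> x - r) \<le> lagrangian f g l x"
      using p by (auto simp: pr mem_characteristic_set_iff)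
    then have "ereal (\<psi> x - r) \<le> ereal c" using lagrangian_le_objective[OF _ x] c order_trans by metis
    then show "p \<in> {p. fst p x - snd p \<le> c}" by (simp add: pr)
  qed
  moreover have "closed {p :: ('a \<Rightarrow> real) \<times> real. fst p x - snd p \<le> c}"
  proof (intro closed_Collect_le continuous_intros)
    show "continuous_on UNIV (\<lambda>p :: ('a \<Rightarrow> real) \<times> real. fst p x)"
      by (rule continuous_on_product_then_coordinatewise) (intro continuous_intros)
  qed
  ultimately have "(\<phi>, s) \<in> {p. fst p x - snd p \<le> c}" using A closure_minimal by blast
  then show "ereal (\<phi> x - s) \<le> ereal c" by simp
qed

lemma epi_conjugate_le_imp_le:
  assumes h: "h \<in> proper_convex_lsc"
    and le: "\<And>\<phi> s. (\<phi>, s) \<in> epi_conjugate h \<Longrightarrow> \<phi> x - s \<le> k"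
  shows "h x \<le> ereal k"
proof (rule ccontr)
  assume "\<not> ?thesis"
  then obtain r where r: "ereal k < ereal r" "ereal r < h x" using ereal_dense2 by (metis not_le)
  obtain \<phi> where "(\<phi>, \<phi> x - r) \<in> epi_conjugate h" using exists_epi_conjugate[OF h r(2)] .
  from le[OF this] r(1) show False by simp
qed

text \<open>A bound on all affine minorants of \<open>f + c g t\<close> bounds the function itself, by the
  Fenchel-Moreau theorem. As \<open>c\<close> may be chosen arbitrarily large, a positive value of \<open>g t x\<close>
  would make \<open>f x + c g t x\<close> exceed the bound \<open>k\<close>. The point \<open>z\<close> makes \<open>f + c g t\<close> proper.\<close>

lemma characteristic_set_bound_imp_feasible:
  assumes f: "f \<in> proper_convex_lsc" and g: "\<And>t. t \<in> T \<Longrightarrow> g t \<in> proper_convex_lsc"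
    and z: "z \<in> feasible_set T g \<inter> effective_domain f"
    and le: "\<And>\<phi> s. (\<phi>, s) \<in> characteristic_set T f g \<Longrightarrow> \<phi> x - s \<le> k"
  shows "x \<in> feasible_set T g" "f x \<le> ereal k"
proof -
  have "(\<lambda>_. 0) \<in> multipliers T" by (simp add: multipliers_def)
  moreover have "lagrangian f g (\<lambda>_. 0) = f" by (simp add: lagrangian_def)
  ultimately have "epi_conjugate f \<subseteq> characteristic_set T f g"
    unfolding characteristic_set_def by (metis UN_upper)
  then show fx: "f x \<le> ereal k" using le by (intro epi_conjugate_le_imp_le[OF f]) auto
  have penal: "f x + ereal c * g t x \<le> ereal k" if t: "t \<in> T" and c: "0 < c" for t c
  proof -
    define l where "l s = (if s = t then c else 0)" for s
    have supp: "{s. l s \<noteq> 0} = {t}" using c by (auto simp: l_def)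
    have "l \<in> multipliers T" using t c supp by (simp add: multipliers_def) (simp add: l_def)
    moreover have "lagrangian f g l = (\<lambda>x. f x + ereal c * g t x)"
      unfolding lagrangian_def supp by (simp add: l_def)
    ultimately have "epi_conjugate (\<lambda>x. f x + ereal c * g t x) \<subseteq> characteristic_set T f g"
      unfolding characteristic_set_def by (metis UN_upper)
    moreover have "g t z < \<infinity>" "f z < \<infinity>"
      using z t by (auto simp: feasible_set_def effective_domain_def intro: le_less_trans)
    then have "(\<lambda>x. f x + ereal c * g t x) \<in> proper_convex_lsc"
      using proper_convex_lsc_add_scaled[OF f g[OF t] _ _ c] by blast
    ultimately show ?thesis using epi_conjugate_le_imp_le[of _ x k] le by blast
  qed
  obtain a where a: "f x = ereal a"
    using f fx by (cases "f x") (auto simp: proper_convex_lsc_def)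
  have "g t x \<le> 0" if t: "t \<in> T" for t
  proof (rule ccontr)
    assume pos: "\<not> ?thesis"
    show False
    proof (cases "g t x")
      case (real \<gamma>)
      have \<gamma>: "0 < \<gamma>" using pos real by simp
      \<comment> \<open>This multiplier makes the left-hand side \<open>a + \<bar>k - a\<bar> + 1 > k\<close>.\<close>
      have "f x + ereal ((\<bar>k - a\<bar> + 1) / \<gamma>) * g t x \<le> ereal k"
        using \<gamma> by (intro penal[OF t]) simp
      then show False using \<gamma> by (simp add: a real)
    next
      case PInf
      then show False using penal[OF t, of 1] by (simp add: a)
    qed (use pos in auto)
  qed
  then show "x \<in> feasible_set T g" by (simp add: feasible_set_def)
qed

text \<open>Together with \<open>closure_characteristic_set_le\<close> this says that, within the dual, the closure of
  the characteristic set is the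
  epigraph of the conjugate of \<open>f\<close> restricted to the feasible set. If \<open>(\<phi>, r)\<close> were not in the
  closure, a separating functional, normalized to be nonvertical, would be a point that is feasible by
  the preceding lemma and at which \<open>\<phi> - r\<close> exceeds \<open>f\<close>. The coefficient \<open>\<alpha>\<close> of the separating
  functional cannot be negative since the characteristic set is closed upwards. A vertical
  functional, \<open>\<alpha> = 0\<close>, is replaced by a nonvertical one, the point reached from the feasible
  point \<open>z\<close> by moving far along \<open>- x\<close>.\<close>

lemma closure_characteristic_set_ge:
  assumes f: "f \<in> proper_convex_lsc" and g: "\<And>t. t \<in> T \<Longrightarrow> g t \<in> proper_convex_lsc"
    and z: "z \<in> feasible_set T g \<inter> effective_domain f"
    and \<phi>: "linear \<phi>" and bound: "\<And>x. x \<in> feasible_set T g \<Longrightarrow> ereal (\<phi> x - r) \<le> f x"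
  shows "(\<phi>, r) \<in> closure (characteristic_set T f g)"
proof (rule ccontr)
  define A where "A = characteristic_set T f g"
  assume "(\<phi>, r) \<notin> closure (characteristic_set T f g)"
  then have notin: "(\<phi>, r) \<notin> closure A" by (simp add: A_def)
  have conv: "convex A"
    unfolding A_def using f g by (intro convex_characteristic_set) (auto simp: proper_convex_lsc_def)
  have up: "(\<psi>, s + c) \<in> A" if "(\<psi>, s) \<in> A" "0 \<le> c" for \<psi> s c
  proof -
    have "ereal (\<psi> x - (s + c)) \<le> ereal (\<psi> x - s)" for x using that by simp
    then show ?thesis using that unfolding A_def mem_characteristic_set_iff by (meson order_trans)
  qed
  have lin: "linear \<psi>" if "(\<psi>, s) \<in> A" for \<psi> s
    using that by (simp add: A_def mem_characteristic_set_iff topological_dual_def)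
  have feasible: "\<not> (\<forall>(\<psi>, s)\<in>A. \<psi> x - s \<le> \<phi> x - r - \<delta>)" if "0 < \<delta>" for x \<delta>
  proof
    assume "\<forall>(\<psi>, s)\<in>A. \<psi> x - s \<le> \<phi> x - r - \<delta>"
    then have *: "x \<in> feasible_set T g" "f x \<le> ereal (\<phi> x - r - \<delta>)"
      using characteristic_set_bound_imp_feasible[OF f g z, of x "\<phi> x - r - \<delta>"]
      unfolding A_def by blast+
    have "ereal (\<phi> x - r) \<le> ereal (\<phi> x - r - \<delta>)" using bound[OF *(1)] *(2) by (rule order_trans)
    then show False using that by simp
  qed
  have ne: "A \<noteq> {}" using feasible[of 1] by auto
  have "\<exists>x \<alpha> \<delta>. 0 < \<delta> \<and> (\<forall>\<psi> s. (\<psi>, s) \<in> A \<longrightarrow> \<delta> \<le> \<psi> x - \<phi> x + \<alpha> * (s - r))"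
    by (rule weak_star_separation[OF conv ne _ \<phi> notin]) (erule lin, meson)
  then obtain x \<alpha> \<delta> where \<delta>: "0 < \<delta>"
    and sep: "\<And>\<psi> s. (\<psi>, s) \<in> A \<Longrightarrow> \<delta> \<le> \<psi> x - \<phi> x + \<alpha> * (s - r)"
    by meson
  obtain \<psi>0 s0 where A0: "(\<psi>0, s0) \<in> A" using ne by auto
  consider "\<alpha> < 0" | "\<alpha> = 0" | "0 < \<alpha>" by linarith
  then show False
  proof cases
    case 1
    \<comment> \<open>Raising \<open>s0\<close> by \<open>K\<close> makes the right-hand side of the separation nonpositive.\<close>
    define K where "K = \<bar>\<psi>0 x - \<phi> x + \<alpha> * (s0 - r)\<bar> / - \<alpha>"
    have K: "\<alpha> * K = - \<bar>\<psi>0 x - \<phi> x + \<alpha> * (s0 - r)\<bar>" "0 \<le> K"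
      using 1 by (auto simp: K_def divide_simps)
    have "\<delta> \<le> \<psi>0 x - \<phi> x + \<alpha> * (s0 + K - r)" by (rule sep[OF up[OF A0 K(2)]])
    also have "\<dots> = \<psi>0 x - \<phi> x + \<alpha> * (s0 - r) + \<alpha> * K" by (simp add: algebra_simps)
    finally show False using K(1) \<delta> by linarith
  next
    case 2
    \<comment> \<open>The factor \<open>K\<close> is chosen so that moving \<open>z\<close> by \<open>- K x\<close> yields the gap \<open>1\<close>.\<close>
    obtain c where c: "f z = ereal c"
      using z f by (cases "f z") (auto simp: effective_domain_def proper_convex_lsc_def)
    define K where "K = (\<bar>c - \<phi> z + r\<bar> + 1) / \<delta>"
    have K: "0 \<le> K" "K * \<delta> = \<bar>c - \<phi> z + r\<bar> + 1" using \<delta> by (auto simp: K_def)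
    have "\<psi> (z - K *\<^sub>R x) - s \<le> \<phi> (z - K *\<^sub>R x) - r - 1" if A: "(\<psi>, s) \<in> A" for \<psi> s
    proof -
      have "(\<psi>, s) \<in> closure (characteristic_set T f g)" using A closure_subset unfolding A_def by blast
      then have "\<psi> z - s \<le> c" using closure_characteristic_set_le[of \<psi> s T f g z] z c by simp
      moreover have "K * \<delta> \<le> K * (\<psi> x - \<phi> x)" using sep[OF A] 2 K(1) by (intro mult_left_mono) auto
      moreover have "\<psi> (z - K *\<^sub>R x) = \<psi> z - K * \<psi> x" "\<phi> (z - K *\<^sub>R x) = \<phi> z - K * \<phi> x"
        using lin[OF A] \<phi> by (simp_all add: linear_diff linear_scale)
      ultimately show ?thesis using K(2) by (simp add: right_diff_distrib)
    qed
    then show False using feasible[of 1 "z - K *\<^sub>R x"] by auto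
  next
    case 3
    have "\<psi> ((- 1 / \<alpha>) *\<^sub>R x) - s \<le> \<phi> ((- 1 / \<alpha>) *\<^sub>R x) - r - \<delta> / \<alpha>" if A: "(\<psi>, s) \<in> A" for \<psi> s
    proof -
      have "\<psi> ((- 1 / \<alpha>) *\<^sub>R x) = - \<psi> x / \<alpha>" "\<phi> ((- 1 / \<alpha>) *\<^sub>R x) = - \<phi> x / \<alpha>"
        using linear_scale[OF lin[OF A], of "- 1 / \<alpha>" x] linear_scale[OF \<phi>, of "- 1 / \<alpha>" x] by auto
      then show ?thesis using sep[OF A] 3 by (simp add: field_simps)
    qed
    then show False using feasible[of "\<delta> / \<alpha>" "(- 1 / \<alpha>) *\<^sub>R x"] \<delta> 3 by auto
  qed
qed

lemma closure_of_weak_star_product: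
  assumes "A \<subseteq> topological_dual \<times> UNIV"
  shows "prod_topology weak_star_topology euclideanreal closure_of A
    = (topological_dual \<times> UNIV) \<inter> closure A"
proof -
  have "prod_topology weak_star_topology euclideanreal
    = subtopology euclidean ((topological_dual :: ('a \<Rightarrow> real) set) \<times> (UNIV :: real set))"
    by (simp add: weak_star_topology_def euclidean_product_topology prod_topology_subtopology(1))
  moreover have "(topological_dual \<times> UNIV) \<inter> A = A" using assms by blast
  ultimately show ?thesis by (simp add: closure_of_subtopology)
qed

section \<open>Zero duality gap\<close>

lemma zero_in_topological_dual: "(\<lambda>_. 0) \<in> topological_dual"
  by (simp add: topological_dual_def linear_zero)

lemma dual_value_le_primal_value: "dual_value T f g \<le> primal_value T f g"
  unfolding dual_value_def primal_value_def
proof (intro SUP_least INF_greatest)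
  fix l x assume "l \<in> multipliers T" "x \<in> feasible_set T g"
  then have "lagrangian f g l x \<le> f x" by (rule lagrangian_le_objective)
  then show "(INF x. lagrangian f g l x) \<le> f x" by (rule INF_lower2[OF UNIV_I])
qed

text \<open>The dual supremum need not be attained, so a level \<open>- r\<close> equal to the dual value may fail to be
  reached by a multiplier, but every strictly smaller level is.\<close>

lemma closure_dual_levels:
  "closure {r. \<exists>l\<in>multipliers T. \<forall>x. ereal (- r) \<le> lagrangian f g l x}
    = {r. ereal (- r) \<le> dual_value T f g}" (is "closure ?R = ?C")
proof (rule antisym)
  have "?R \<subseteq> ?C"
  proof
    fix r assume "r \<in> ?R"
    then obtain l where l: "l \<in> multipliers T" "ereal (- r) \<le> (INF x. lagrangian f g l x)"
      by (auto simp: le_INF_iff)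
    then have "ereal (- r) \<le> dual_value T f g"
      by (auto simp: dual_value_def intro: SUP_upper2)
    then show "r \<in> ?C" by simp
  qed
  moreover have "closed ?C" by (intro closed_Collect_le continuous_intros)
  ultimately show "closure ?R \<subseteq> ?C" by (rule closure_minimal)
  show "?C \<subseteq> closure ?R"
  proof
    fix r assume r: "r \<in> ?C"
    have "\<exists>y\<in>?R. dist y r < e" if "0 < e" for e
    proof -
      have "ereal (- (r + e / 2)) < ereal (- r)" using that by simp
      also have "\<dots> \<le> dual_value T f g" using r by simp
      finally obtain l where l: "l \<in> multipliers T" "ereal (- (r + e / 2)) < (INF x. lagrangian f g l x)"
        by (auto simp: dual_value_def less_SUP_iff)
      then have "ereal (- (r + e / 2)) \<le> lagrangian f g l x" for x
        by (meson INF_lower UNIV_I less_imp_le order_trans)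
      then show ?thesis using l(1) that
        by (intro bexI[of _ "r + e / 2"]) (auto simp: dist_real_def)
    qed
    then show "r \<in> closure ?R" by (simp add: closure_approachable)
  qed
qed

lemma ereal_eq_if_same_real_lower_bounds:
  fixes a b :: ereal
  assumes "a \<le> b" "\<And>r. ereal r \<le> b \<Longrightarrow> ereal r \<le> a"
  shows "a = b"
proof (rule ccontr)
  assume "a \<noteq> b"
  with assms(1) obtain r where r: "a < ereal r" "ereal r < b" using ereal_dense2 by (metis order_less_le)
  then have "ereal r \<le> a" by (intro assms(2)) simp
  with r(1) show False by simp
qed

theorem corollary6p1:
  fixes T :: "'i set"
    and f :: "'a::locally_convex_t2 \<Rightarrow> ereal"
    and g :: "'i \<Rightarrow> 'a \<Rightarrow> ereal"
  defines "A \<equiv> characteristic_set T f g"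
    and "Z \<equiv> {\<lambda>_::'a. 0 :: real} \<times> (UNIV :: real set)"
    and "\<tau> \<equiv> prod_topology weak_star_topology euclideanreal"
  assumes "infinite T"
    and "f \<in> proper_convex_lsc"
    and "\<And>t. t \<in> T \<Longrightarrow> g t \<in> proper_convex_lsc"
    and "feasible_set T g \<inter> effective_domain f \<noteq> {}"
  shows "primal_value T f g = dual_value T f g \<longleftrightarrow>
    (\<tau> closure_of A) \<inter> Z = \<tau> closure_of (A \<inter> Z)"
proof -
  have zero: "(\<lambda>_::'a. 0) \<in> topological_dual" by (rule zero_in_topological_dual)
  define R where "R = {r. \<exists>l\<in>multipliers T. \<forall>x. ereal (- r) \<le> lagrangian f g l x}"
  obtain z where z: "z \<in> feasible_set T g \<inter> effective_domain f" using assms(7) by blast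
  have A: "A \<subseteq> topological_dual \<times> UNIV" by (auto simp: A_def mem_characteristic_set_iff)
  have "(\<lambda>_. 0, r) \<in> closure A \<longleftrightarrow> ereal (- r) \<le> primal_value T f g" for r
    using closure_characteristic_set_le[of "\<lambda>_. 0" r T f g]
      closure_characteristic_set_ge[OF assms(5,6) z linear_zero, of r]
    by (auto simp: A_def primal_value_def le_INF_iff)
  then have left: "(\<tau> closure_of A) \<inter> Z = {\<lambda>_. 0} \<times> {r. ereal (- r) \<le> primal_value T f g}"
    using zero
    by (auto simp: \<tau>_def closure_of_weak_star_product[OF A] Z_def)
  have "(\<lambda>_. 0, r) \<in> A \<longleftrightarrow> r \<in> R" for r
    using zero by (simp add: A_def R_def mem_characteristic_set_iff)
  then have "A \<inter> Z = {\<lambda>_. 0} \<times> R" by (auto simp: Z_def)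
  moreover have "closed {\<lambda>_::'a. 0 :: real}"
  proof -
    have "closedin (powertop_real UNIV) {\<lambda>_::'a. 0}"
      by (rule closedin_Hausdorff_singleton) (simp_all add: Hausdorff_space_product_topology)
    then show ?thesis by (simp add: euclidean_product_topology)
  qed
  ultimately have "closure (A \<inter> Z) = {\<lambda>_. 0} \<times> {r. ereal (- r) \<le> dual_value T f g}"
    using closure_dual_levels[of T f g] by (simp add: closure_Times R_def)
  then have right: "\<tau> closure_of (A \<inter> Z) = {\<lambda>_. 0} \<times> {r. ereal (- r) \<le> dual_value T f g}"
    using zero A closure_of_weak_star_product[of "A \<inter> Z"]
    by (auto simp: \<tau>_def)
  have "(\<tau> closure_of A) \<inter> Z = \<tau> closure_of (A \<inter> Z)
    \<longleftrightarrow> (\<forall>r. ereal (- r) \<le> primal_value T f g \<longleftrightarrow> ereal (- r) \<le> dual_value T f g)"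
    unfolding left right by (auto simp: set_eq_iff)
  also have "\<dots> \<longleftrightarrow> dual_value T f g = primal_value T f g"
  proof
    assume *: "\<forall>r. ereal (- r) \<le> primal_value T f g \<longleftrightarrow> ereal (- r) \<le> dual_value T f g"
    show "dual_value T f g = primal_value T f g"
    proof (rule ereal_eq_if_same_real_lower_bounds[OF dual_value_le_primal_value])
      fix r assume "ereal r \<le> primal_value T f g"
      with *[rule_format, of "- r"] show "ereal r \<le> dual_value T f g" by simp
    qed
  qed simp
  finally show ?thesis by auto
qed

end
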